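(* Let $G$ be a non-trivial locally compact group (i.e. $G$ has more than one element). If $G$ is either abelian or compact, then no wavelet space associated to $G$ is fully interpolating; that is, for every square integrable representation $\pi:G\to\mathcal{U}(\mathcal{H}_\pi)$ and every admissible vector $g\in\mathcal{H}_\pi$, the wavelet space $\mathcal{W}_g(\mathcal{H}_\pi)$ is not fully interpolating.
   Context: Locally compact groups are Hausdorff, $L^2(G)$ is taken with respect to a fixed left Haar measure, and inner products are linear in the first argument. A unitary representation $\pi:G\to\mathcal{U}(\mathcal{H}_{\pi})$ is a group homomorphism into the unitary operators of a Hilbert space such that for all $f,g\in\mathcal{H}_\pi$ the function (wavelet transform) $\mathcal{W}_{g}f(x):=\langle f,\pi(x)g\rangle_{\mathcal{H}_\pi}$ is continuous on $G$. It is irreducible if its only closed invariant subspaces are $\{0\}$ and $\mathcal{H}_\pi$. A square integrable representation is an irreducible unitary representation $\pi$ for which there is a non-zero $g\in\mathcal{H}_\pi$ with $\mathcal{W}_g g\in L^2(G)$; such a $g$ is called a square integrable vector. By the Duflo-Moore theorem there is a unique positive, densely defined, injective operator $C_\pi$ on $\mathcal{H}_\pi$, whose domain consists of $0$ and the square integrable vectors, with $\langle\mathcal{W}_{g_1}f_1,\mathcal{W}_{g_2}f_2\rangle_{L^2(G)}=\langle f_1,f_2\rangle\,\overline{\langle C_\pi g_1,C_\pi g_2\rangle}$ for all $f_1,f_2\in\mathcal{H}_\pi$ and $g_1,g_2\in\mathrm{dom}(C_\pi)$. A square integrable vector $g$ is admissible if $\|C_\pi g\|=1$; equivalently, $\mathcal{W}_g:\mathcal{H}_\pi\to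 L^2(G)$ is an isometry. For $g$ admissible, the wavelet space is $\mathcal{W}_g(\mathcal{H}_\pi):=\{\mathcal{W}_g f: f\in\mathcal{H}_\pi\}\subset L^2(G)$ with the $L^2(G)$-norm; it is a reproducing kernel Hilbert space on $G$ with reproducing kernel $K(x,y)=\langle\pi(y)g,\pi(x)g\rangle$. A reproducing kernel Hilbert space on a set $X$ with kernel $K$ is fully interpolating if for every finite set $\Omega=\{x_1,\dots,x_m\}\subset X$ of distinct points the matrix $K_\Omega=\{K(x_i,x_j)\}_{i,j=1}^m$ is strictly positive definite (equivalently, for all distinct $x_1,\dots,x_m\in X$ and all $\lambda_1,\dots,\lambda_m\in\mathbb{C}$ there is a function $F$ in the space with $F(x_i)=\lambda_i$ for all $i$). *)

theory Defs
  imports "HOL-Analysis.Analysis"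
begin

section \<open>Complex Hilbert spaces\<close>

text \<open>Completeness comes from the class banach; the inner product is linear in its first argument.\<close>

class chilbert_space = banach +
  fixes scaleC :: "complex \<Rightarrow> 'a \<Rightarrow> 'a" (infixr \<open>*\<^sub>C\<close> 75)
    and cinner :: "'a \<Rightarrow> 'a \<Rightarrow> complex"
  assumes scaleC_add_right: "a *\<^sub>C (x + y) = a *\<^sub>C x + a *\<^sub>C y"
    and scaleC_add_left: "(a + b) *\<^sub>C x = a *\<^sub>C x + b *\<^sub>C x"
    and scaleC_scaleC: "a *\<^sub>C (b *\<^sub>C x) = (a * b) *\<^sub>C x"
    and scaleC_of_real: "complex_of_real r *\<^sub>C x = r *\<^sub>R x"
    and cinner_commute: "cinner x y = cnj (cinner y x)"
    and cinner_add_left: "cinner (x + y) z = cinner x z + cinner y z"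
    and cinner_scaleC_left: "cinner (a *\<^sub>C x) y = a * cinner x y"
    and cinner_self: "cinner x x = complex_of_real ((norm x)\<^sup>2)"

instantiation complex :: chilbert_space
begin
definition "scaleC_complex (a::complex) (x::complex) = a * x"
definition "cinner_complex (x::complex) (y::complex) = x * cnj y"
instance
  by standard (auto simp: scaleC_complex_def cinner_complex_def algebra_simps scaleR_conv_of_real
      complex_norm_square simp del: of_real_power)
end

definition csubspace :: "'h::chilbert_space set \<Rightarrow> bool" where
  "csubspace S \<longleftrightarrow>
     0 \<in> S \<and> (\<forall>x\<in>S. \<forall>y\<in>S. x + y \<in> S) \<and> (\<forall>a. \<forall>x\<in>S. a *\<^sub>C x \<in> S)"

definition unitary_operator :: "('h::chilbert_space \<Rightarrow> 'h) \<Rightarrow> bool" where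
  "unitary_operator U \<longleftrightarrow>
     (\<forall>x y. U (x + y) = U x + U y) \<and> (\<forall>a x. U (a *\<^sub>C x) = a *\<^sub>C U x) \<and>
     (\<forall>x y. cinner (U x) (U y) = cinner x y) \<and> surj U"

section \<open>Haar measure\<close>

text \<open>
  Topological groups are written additively, following the library class topological_group_add,
  which does not include commutativity.  A left Haar measure is a nonzero left-invariant Radon measure
  on the Borel sets: finite on compact sets, outer regular on Borel sets and inner regular
  on open sets.
\<close>

definition left_haar_measure :: "'g::topological_group_add measure \<Rightarrow> bool" where
  "left_haar_measure \<mu> \<longleftrightarrow>
     sets \<mu> = sets borel \<and>
     emeasure \<mu> UNIV \<noteq> 0 \<and>
     (\<forall>K. compact K \<longrightarrow> emeasure \<mu> K < \<infinity>) \<and>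
     (\<forall>A\<in>sets borel. emeasure \<mu> A = (INF U\<in>{U. open U \<and> A \<subseteq> U}. emeasure \<mu> U)) \<and>
     (\<forall>U. open U \<longrightarrow> emeasure \<mu> U = (SUP K\<in>{K. compact K \<and> K \<subseteq> U}. emeasure \<mu> K)) \<and>
     (\<forall>a. \<forall>A\<in>sets borel. emeasure \<mu> ((\<lambda>x. a + x) ` A) = emeasure \<mu> A)"

definition L2_function :: "'g measure \<Rightarrow> ('g \<Rightarrow> complex) \<Rightarrow> bool" where
  "L2_function \<mu> F \<longleftrightarrow> F \<in> borel_measurable \<mu> \<and> integrable \<mu> (\<lambda>x. (norm (F x))\<^sup>2)"

definition L2_inner :: "'g measure \<Rightarrow> ('g \<Rightarrow> complex) \<Rightarrow> ('g \<Rightarrow> complex) \<Rightarrow> complex" where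
  "L2_inner \<mu> F H = (LINT x|\<mu>. F x * cnj (H x))"

section \<open>Square integrable representations\<close>

definition wavelet :: "('g \<Rightarrow> 'h \<Rightarrow> 'h::chilbert_space) \<Rightarrow> 'h \<Rightarrow> 'h \<Rightarrow> 'g \<Rightarrow> complex" where
  "wavelet \<pi> g f = (\<lambda>x. cinner f (\<pi> x g))"

definition unitary_representation ::
    "('g::topological_group_add \<Rightarrow> 'h \<Rightarrow> 'h::chilbert_space) \<Rightarrow> bool" where
  "unitary_representation \<pi> \<longleftrightarrow>
     (\<forall>x. unitary_operator (\<pi> x)) \<and> (\<forall>x y. \<pi> (x + y) = \<pi> x \<circ> \<pi> y) \<and>
     (\<forall>f g. continuous_on UNIV (wavelet \<pi> g f))"

definition irreducible_representation :: "('g \<Rightarrow> 'h \<Rightarrow> 'h::chilbert_space) \<Rightarrow> bool" where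
  "irreducible_representation \<pi> \<longleftrightarrow>
     (\<forall>S. csubspace S \<and> closed S \<and> (\<forall>x. \<pi> x ` S \<subseteq> S) \<longrightarrow> S = {0} \<or> S = UNIV)"

definition square_integrable_vector ::
    "'g measure \<Rightarrow> ('g \<Rightarrow> 'h \<Rightarrow> 'h::chilbert_space) \<Rightarrow> 'h \<Rightarrow> bool" where
  "square_integrable_vector \<mu> \<pi> g \<longleftrightarrow> g \<noteq> 0 \<and> L2_function \<mu> (wavelet \<pi> g g)"

definition square_integrable_representation ::
    "'g::topological_group_add measure \<Rightarrow> ('g \<Rightarrow> 'h \<Rightarrow> 'h::chilbert_space) \<Rightarrow> bool" where
  "square_integrable_representation \<mu> \<pi> \<longleftrightarrow>
     unitary_representation \<pi> \<and> irreducible_representation \<pi> \<and>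
     (\<exists>g. square_integrable_vector \<mu> \<pi> g)"

definition duflo_moore_domain ::
    "'g measure \<Rightarrow> ('g \<Rightarrow> 'h \<Rightarrow> 'h::chilbert_space) \<Rightarrow> 'h set" where
  "duflo_moore_domain \<mu> \<pi> = insert 0 {g. square_integrable_vector \<mu> \<pi> g}"

text \<open>
  An unbounded operator is a total function that is only constrained on its domain.
  That the wavelet transforms lie in $L^2$ is stated explicitly, because the Bochner
  integral of a non-integrable function is 0 by convention.
\<close>

definition duflo_moore_operator ::
    "'g measure \<Rightarrow> ('g \<Rightarrow> 'h \<Rightarrow> 'h::chilbert_space) \<Rightarrow> ('h \<Rightarrow> 'h) \<Rightarrow> bool" where
  "duflo_moore_operator \<mu> \<pi> C \<longleftrightarrow>
     (let D = duflo_moore_domain \<mu> \<pi> in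
       csubspace D \<and> closure D = UNIV \<and>
       (\<forall>g\<in>D. \<forall>h\<in>D. C (g + h) = C g + C h) \<and> (\<forall>a. \<forall>g\<in>D. C (a *\<^sub>C g) = a *\<^sub>C C g) \<and>
       (\<forall>g\<in>D. cinner (C g) g \<in> \<real> \<and> Re (cinner (C g) g) \<ge> 0) \<and>
       inj_on C D \<and>
       (\<forall>g\<in>D. \<forall>f. L2_function \<mu> (wavelet \<pi> g f)) \<and>
       (\<forall>g1\<in>D. \<forall>g2\<in>D. \<forall>f1 f2.
          L2_inner \<mu> (wavelet \<pi> g1 f1) (wavelet \<pi> g2 f2) =
          cinner f1 f2 * cnj (cinner (C g1) (C g2))))"

text \<open>
  The Duflo-Moore theorem provides an operator as required here; the lemma
  duflo_moore_operator_norm below shows that the value of $\|C g\|$ does not depend on its choice.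
\<close>

definition admissible :: "'g measure \<Rightarrow> ('g \<Rightarrow> 'h \<Rightarrow> 'h::chilbert_space) \<Rightarrow> 'h \<Rightarrow> bool" where
  "admissible \<mu> \<pi> g \<longleftrightarrow>
     square_integrable_vector \<mu> \<pi> g \<and> (\<exists>C. duflo_moore_operator \<mu> \<pi> C \<and> norm (C g) = 1)"

definition wavelet_space :: "('g \<Rightarrow> 'h \<Rightarrow> 'h::chilbert_space) \<Rightarrow> 'h \<Rightarrow> ('g \<Rightarrow> complex) set" where
  "wavelet_space \<pi> g = range (wavelet \<pi> g)"

section \<open>Reproducing kernel Hilbert spaces\<close>

text \<open>
  A reproducing kernel Hilbert space on the type 'a is given by its set of functions, its
  inner product (relevant only on that set) and its kernel.
\<close>

definition rkhs :: "('a \<Rightarrow> complex) set \<Rightarrow>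
    (('a \<Rightarrow> complex) \<Rightarrow> ('a \<Rightarrow> complex) \<Rightarrow> complex) \<Rightarrow> ('a \<Rightarrow> 'a \<Rightarrow> complex) \<Rightarrow> bool" where
  "rkhs V ip K \<longleftrightarrow>
     (\<lambda>x. 0) \<in> V \<and> (\<forall>F\<in>V. \<forall>H\<in>V. (\<lambda>x. F x + H x) \<in> V) \<and> (\<forall>a. \<forall>F\<in>V. (\<lambda>x. a * F x) \<in> V) \<and>
     (\<forall>F1\<in>V. \<forall>F2\<in>V. \<forall>H\<in>V. ip (\<lambda>x. F1 x + F2 x) H = ip F1 H + ip F2 H) \<and>
     (\<forall>a. \<forall>F\<in>V. \<forall>H\<in>V. ip (\<lambda>x. a * F x) H = a * ip F H) \<and>
     (\<forall>F\<in>V. \<forall>H\<in>V. ip F H = cnj (ip H F)) \<and>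
     (\<forall>F\<in>V. Re (ip F F) \<ge> 0 \<and> (ip F F = 0 \<longrightarrow> F = (\<lambda>x. 0))) \<and>
     (\<forall>u. (\<forall>n. u n \<in> V) \<and>
          (\<forall>e>0. \<exists>N. \<forall>m\<ge>N. \<forall>n\<ge>N.
             sqrt (Re (ip (\<lambda>x. u m x - u n x) (\<lambda>x. u m x - u n x))) < e) \<longrightarrow>
          (\<exists>F\<in>V. (\<lambda>n::nat. sqrt (Re (ip (\<lambda>x. u n x - F x) (\<lambda>x. u n x - F x)))) \<longlonglongrightarrow> 0)) \<and>
     (\<forall>y. (\<lambda>x. K x y) \<in> V) \<and>
     (\<forall>y. \<forall>F\<in>V. F y = ip F (\<lambda>x. K x y))"

text \<open>Strict positive definiteness of the matrix with entries $K(x,y)$ for $x, y \in \Omega$.\<close>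

definition strictly_positive_definite_on :: "'a set \<Rightarrow> ('a \<Rightarrow> 'a \<Rightarrow> complex) \<Rightarrow> bool" where
  "strictly_positive_definite_on \<Omega> K \<longleftrightarrow>
     (\<forall>c. (\<exists>x\<in>\<Omega>. c x \<noteq> 0) \<longrightarrow>
        (\<Sum>x\<in>\<Omega>. \<Sum>y\<in>\<Omega>. cnj (c x) * K x y * c y) \<in> \<real> \<and>
        Re (\<Sum>x\<in>\<Omega>. \<Sum>y\<in>\<Omega>. cnj (c x) * K x y * c y) > 0)"

definition fully_interpolating :: "('a \<Rightarrow> complex) set \<Rightarrow>
    (('a \<Rightarrow> complex) \<Rightarrow> ('a \<Rightarrow> complex) \<Rightarrow> complex) \<Rightarrow> bool" where
  "fully_interpolating V ip \<longleftrightarrow>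
     (\<exists>K. rkhs V ip K \<and> (\<forall>\<Omega>. finite \<Omega> \<longrightarrow> strictly_positive_definite_on \<Omega> K))"

lemma rkhs_kernel_mem: "rkhs V ip K \<Longrightarrow> (\<lambda>x. K x y) \<in> V"
  unfolding rkhs_def by (elim conjE) (rule spec)

lemma rkhs_reproducing: "rkhs V ip K \<Longrightarrow> F \<in> V \<Longrightarrow> F y = ip F (\<lambda>x. K x y)"
  unfolding rkhs_def by (elim conjE) (drule spec, erule bspec)

lemma rkhs_commute: "rkhs V ip K \<Longrightarrow> F \<in> V \<Longrightarrow> H \<in> V \<Longrightarrow> ip F H = cnj (ip H F)"
  unfolding rkhs_def by (elim conjE) (metis (no_types, lifting))

lemma rkhs_kernel_unique:
  assumes "rkhs V ip K" "rkhs V ip K'"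
  shows "K = K'"
proof (intro ext)
  fix x y
  note V = rkhs_kernel_mem[OF assms(1)] rkhs_kernel_mem[OF assms(2)]
  note r = rkhs_reproducing[OF assms(1)] rkhs_reproducing[OF assms(2)]
  note s = rkhs_commute[OF assms(1)]
  have 1: "K x y = ip (\<lambda>z. K z y) (\<lambda>z. K' z x)" using r(2)[OF V(1)] .
  have 2: "K' y x = ip (\<lambda>z. K' z x) (\<lambda>z. K z y)" using r(1)[OF V(2)] .
  have 3: "K' y x = ip (\<lambda>z. K' z x) (\<lambda>z. K' z y)" using r(2)[OF V(2)] .
  have 4: "K' x y = ip (\<lambda>z. K' z y) (\<lambda>z. K' z x)" using r(2)[OF V(2)] .
  have "K x y = cnj (K' y x)" unfolding 1 2 by (rule s[OF V])
  also have "\<dots> = K' x y" unfolding 3 4 by (rule s[OF V(2) V(2), symmetric])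
  finally show "K x y = K' x y" .
qed

section \<open>Consistency of the definitions\<close>

lemma cinner_zero_left: "cinner 0 (y::'h::chilbert_space) = 0"
  using cinner_add_left[of 0 0 y] by simp

lemma cinner_diff_left: "cinner (x - y) z = cinner x z - cinner (y::'h::chilbert_space) z"
  using cinner_add_left[of "x - y" y z] by simp

lemma duflo_moore_operator_norm:
  fixes \<pi> :: "'g \<Rightarrow> 'h \<Rightarrow> 'h::chilbert_space"
  assumes "duflo_moore_operator \<mu> \<pi> C" "duflo_moore_operator \<mu> \<pi> C'"
    and g: "square_integrable_vector \<mu> \<pi> g"
  shows "norm (C g) = norm (C' g)"
proof -
  have gD: "g \<in> duflo_moore_domain \<mu> \<pi>" using g by (simp add: duflo_moore_domain_def)
  have "cinner g g * cnj (cinner (C g) (C g)) = cinner g g * cnj (cinner (C' g) (C' g))"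
    using assms(1,2) gD unfolding duflo_moore_operator_def Let_def by metis
  moreover have "cinner g g \<noteq> 0" using g
    by (simp add: square_integrable_vector_def cinner_self)
  ultimately have "cnj (cinner (C g) (C g)) = cnj (cinner (C' g) (C' g))" by simp
  then have "(norm (C g))\<^sup>2 = (norm (C' g))\<^sup>2"
    unfolding cinner_self complex_cnj_complex_of_real by (simp only: of_real_eq_iff)
  then show ?thesis by simp
qed

lemma admissible_isometry:
  fixes \<pi> :: "'g \<Rightarrow> 'h \<Rightarrow> 'h::chilbert_space"
  assumes "admissible \<mu> \<pi> g"
  shows "L2_function \<mu> (wavelet \<pi> g f)"
    and "L2_inner \<mu> (wavelet \<pi> g f) (wavelet \<pi> g f') = cinner f f'"
proof -
  obtain C where C: "duflo_moore_operator \<mu> \<pi> C" "norm (C g) = 1"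
    using assms by (auto simp: admissible_def)
  have gD: "g \<in> duflo_moore_domain \<mu> \<pi>"
    using assms by (simp add: duflo_moore_domain_def admissible_def)
  show "L2_function \<mu> (wavelet \<pi> g f)"
    using C gD unfolding duflo_moore_operator_def Let_def by blast
  have "L2_inner \<mu> (wavelet \<pi> g f) (wavelet \<pi> g f') = cinner f f' * cnj (cinner (C g) (C g))"
    using C gD unfolding duflo_moore_operator_def Let_def by blast
  then show "L2_inner \<mu> (wavelet \<pi> g f) (wavelet \<pi> g f') = cinner f f'"
    by (simp add: cinner_self C(2))
qed

lemma wavelet_space_rkhs:
  fixes \<pi> :: "'g \<Rightarrow> 'h \<Rightarrow> 'h::chilbert_space"
  assumes "admissible \<mu> \<pi> g"
  shows "rkhs (wavelet_space \<pi> g) (L2_inner \<mu>) (\<lambda>x y. cinner (\<pi> y g) (\<pi> x g))"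
proof -
  let ?W = "wavelet \<pi> g"
  note iso = admissible_isometry(2)[OF assms]
  have add: "(\<lambda>x. ?W f x + ?W h x) = ?W (f + h)" for f h
    by (simp add: wavelet_def cinner_add_left)
  have diff: "(\<lambda>x. ?W f x - ?W h x) = ?W (f - h)" for f h
    by (simp add: wavelet_def cinner_diff_left)
  have scale: "(\<lambda>x. a * ?W f x) = ?W (a *\<^sub>C f)" for a f
    by (simp add: wavelet_def cinner_scaleC_left)
  have zero: "(\<lambda>x. 0) = ?W 0"
    by (simp add: wavelet_def cinner_zero_left)
  have ker: "(\<lambda>x. cinner (\<pi> y g) (\<pi> x g)) = ?W (\<pi> y g)" for y
    by (simp add: wavelet_def)
  have nrm: "sqrt (Re (L2_inner \<mu> (?W f) (?W f))) = norm f" for f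
    by (simp add: iso cinner_self del: of_real_power)
  have complete: "\<exists>F\<in>range ?W. (\<lambda>n. sqrt (Re (L2_inner \<mu> (\<lambda>x. u n x - F x) (\<lambda>x. u n x - F x)))) \<longlonglongrightarrow> 0"
    if u: "\<forall>n. u n \<in> range ?W"
      and cau: "\<forall>e>0. \<exists>N. \<forall>m\<ge>N. \<forall>n\<ge>N.
        sqrt (Re (L2_inner \<mu> (\<lambda>x. u m x - u n x) (\<lambda>x. u m x - u n x))) < e" for u :: "nat \<Rightarrow> 'g \<Rightarrow> complex"
  proof -
    from u have "\<exists>v. \<forall>n. u n = ?W (v n)" by (intro choice) blast
    then obtain v where v: "\<And>n. u n = ?W (v n)" by blast
    have "Cauchy v"
      using cau unfolding v diff nrm Cauchy_def dist_norm .
    then obtain l where "v \<longlonglongrightarrow> l" using Cauchy_convergent convergentD by blast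
    then have "(\<lambda>n. norm (v n - l)) \<longlonglongrightarrow> 0"
      using LIM_zero tendsto_norm_zero by blast
    then show ?thesis
      by (intro bexI[of _ "?W l"]) (simp_all add: v diff nrm)
  qed
  show ?thesis
    unfolding rkhs_def wavelet_space_def
  proof (intro conjI)
    show "(\<lambda>x. 0) \<in> range ?W" by (simp add: zero)
    show "\<forall>F\<in>range ?W. \<forall>H\<in>range ?W. (\<lambda>x. F x + H x) \<in> range ?W" by (auto simp: add)
    show "\<forall>a. \<forall>F\<in>range ?W. (\<lambda>x. a * F x) \<in> range ?W" by (auto simp: scale)
    show "\<forall>F1\<in>range ?W. \<forall>F2\<in>range ?W. \<forall>H\<in>range ?W.
        L2_inner \<mu> (\<lambda>x. F1 x + F2 x) H = L2_inner \<mu> F1 H + L2_inner \<mu> F2 H"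
      by (auto simp: add iso cinner_add_left)
    show "\<forall>a. \<forall>F\<in>range ?W. \<forall>H\<in>range ?W. L2_inner \<mu> (\<lambda>x. a * F x) H = a * L2_inner \<mu> F H"
      by (auto simp: scale iso cinner_scaleC_left)
    show "\<forall>F\<in>range ?W. \<forall>H\<in>range ?W. L2_inner \<mu> F H = cnj (L2_inner \<mu> H F)"
      using cinner_commute by (auto simp: iso)
    show "\<forall>F\<in>range ?W. Re (L2_inner \<mu> F F) \<ge> 0 \<and> (L2_inner \<mu> F F = 0 \<longrightarrow> F = (\<lambda>x. 0))"
      by (auto simp: iso cinner_self zero simp del: of_real_power)
    show "\<forall>u. (\<forall>n. u n \<in> range ?W) \<and>
          (\<forall>e>0. \<exists>N. \<forall>m\<ge>N. \<forall>n\<ge>N.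
             sqrt (Re (L2_inner \<mu> (\<lambda>x. u m x - u n x) (\<lambda>x. u m x - u n x))) < e) \<longrightarrow>
          (\<exists>F\<in>range ?W. (\<lambda>n::nat. sqrt (Re (L2_inner \<mu> (\<lambda>x. u n x - F x) (\<lambda>x. u n x - F x)))) \<longlonglongrightarrow> 0)"
      using complete by blast
    show "\<forall>y. (\<lambda>x. cinner (\<pi> y g) (\<pi> x g)) \<in> range ?W" by (simp add: ker)
    show "\<forall>y. \<forall>F\<in>range ?W. F y = L2_inner \<mu> F (\<lambda>x. cinner (\<pi> y g) (\<pi> x g))"
      by (auto simp: ker iso) (simp add: wavelet_def)
  qed
qed

lemma fully_interpolating_wavelet_space:
  fixes \<pi> :: "'g \<Rightarrow> 'h \<Rightarrow> 'h::chilbert_space"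
  assumes "admissible \<mu> \<pi> g"
  shows "fully_interpolating (wavelet_space \<pi> g) (L2_inner \<mu>) \<longleftrightarrow>
    (\<forall>\<Omega>. finite \<Omega> \<longrightarrow> strictly_positive_definite_on \<Omega> (\<lambda>x y. cinner (\<pi> y g) (\<pi> x g)))"
  using rkhs_kernel_unique[OF _ wavelet_space_rkhs[OF assms]] wavelet_space_rkhs[OF assms]
  unfolding fully_interpolating_def by metis

end

theory Submission
  imports Defs
begin

text \<open>
  Write $K(x,y) = \langle \pi(y) g, \pi(x) g\rangle$.  The quadratic form of $K$ at a coefficient
  family $c$ on a finite set of points is $\|\sum_x c(x)\, \pi(x) g\|^2$, so full interpolation says
  precisely that the orbit vectors $\pi(x) g$, for distinct $x$, are linearly independent
  (\<open>orbit_independent\<close>).  It is enough to exhibit one non-trivial linear relation in the orbit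
  of $g$.

  If $G$ is abelian, then $W_g(\pi(y) f) = W_{\pi(-y) g} f$.  Evaluating
  $\langle W_g(\pi(y) f_1), W_g f_2\rangle$ by the orthogonality relations in these two ways shows
  that $\langle \pi(y) f_1, f_2\rangle$ is a multiple of $\langle f_1, f_2\rangle$ by a factor that
  depends on $y$ only.  Hence $\pi(y)$ is a scalar (\<open>abelian_acts_by_scalars\<close>), which replaces the
  usual appeal to Schur's lemma, and any two vectors of the orbit are proportional.

  If $G$ is compact, then integrating Bessel's inequality
  $\sum_{e \in E} |W_g e(x)|^2 \le \|g\|^2$ over $G$ bounds the size of an orthonormal set $E$ by
  $\mu(G) \|g\|^2$, because $W_g$ is an isometry.  So the Hilbert space is finite-dimensional
  (\<open>finite_measure_imp_finitely_spanned\<close>), and an infinite $G$ has too many orbit vectors.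

  If $G$ is finite, counting dimensions is not enough, and the trivial representation
  decides: the vectors fixed by $G$ form a closed invariant subspace.  Either all vectors are fixed
  and the orbit is a point, although $G$ is not, or only $0$ is fixed and then the fixed vector
  $\sum_x \pi(x) g$ is a relation (\<open>finite_group_orbit_relation\<close>).
\<close>

section \<open>Complex inner products\<close>

lemma cinner_add_right: "cinner x (y + z) = cinner x y + cinner x (z::'h::chilbert_space)"
  by (metis cinner_commute cinner_add_left complex_cnj_add)

lemma cinner_scaleC_right: "cinner x (a *\<^sub>C y) = cnj a * cinner x (y::'h::chilbert_space)"
  by (metis cinner_commute cinner_scaleC_left complex_cnj_mult)

lemma cinner_zero_right: "cinner (x::'h::chilbert_space) 0 = 0"
  by (metis cinner_commute cinner_zero_left complex_cnj_zero)

lemma cinner_sum_left: "cinner (\<Sum>i\<in>I. v i) (w::'h::chilbert_space) = (\<Sum>i\<in>I. cinner (v i) w)"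
  by (induction I rule: infinite_finite_induct) (auto simp: cinner_zero_left cinner_add_left)

lemma cinner_sum_right: "cinner (w::'h::chilbert_space) (\<Sum>i\<in>I. v i) = (\<Sum>i\<in>I. cinner w (v i))"
  by (induction I rule: infinite_finite_induct) (auto simp: cinner_zero_right cinner_add_right)

lemma cinner_self_eq_0_iff: "cinner x x = 0 \<longleftrightarrow> (x::'h::chilbert_space) = 0"
  by (simp add: cinner_self del: of_real_power)

lemma scaleC_one: "1 *\<^sub>C (x::'h::chilbert_space) = x"
  using scaleC_of_real[of 1 x] by simp

lemma scaleC_minus_one: "(-1) *\<^sub>C (x::'h::chilbert_space) = - x"
  using scaleC_of_real[of "-1" x] by simp

section \<open>Finite orthonormal sets\<close>

definition orthonormal_set :: "'h::chilbert_space set \<Rightarrow> bool" where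
  "orthonormal_set E \<longleftrightarrow>
     finite E \<and> (\<forall>e\<in>E. norm e = 1) \<and> (\<forall>e\<in>E. \<forall>e'\<in>E. e \<noteq> e' \<longrightarrow> cinner e e' = 0)"

definition projection_onto :: "'h::chilbert_space set \<Rightarrow> 'h \<Rightarrow> 'h" where
  "projection_onto E v = (\<Sum>e\<in>E. cinner v e *\<^sub>C e)"

lemma cinner_residual_orthonormal:
  assumes E: "orthonormal_set E" and "e \<in> E"
  shows "cinner (v - projection_onto E v) e = 0"
proof -
  have "cinner (projection_onto E v) e = (\<Sum>e'\<in>E. cinner v e' * cinner e' e)"
    by (simp add: projection_onto_def cinner_sum_left cinner_scaleC_left)
  also have "\<dots> = (\<Sum>e'\<in>E. if e' = e then cinner v e else 0)"
    using E \<open>e \<in> E\<close> by (intro sum.cong) (auto simp: orthonormal_set_def cinner_self)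
  also have "\<dots> = cinner v e"
    using E \<open>e \<in> E\<close> by (simp add: orthonormal_set_def)
  finally show ?thesis by (simp add: cinner_diff_left)
qed

lemma Bessel_inequality:
  assumes E: "orthonormal_set E"
  shows "(\<Sum>e\<in>E. (norm (cinner v e))\<^sup>2) \<le> (norm v)\<^sup>2"
proof -
  let ?r = "v - projection_onto E v"
  have r: "cinner ?r e = 0" if "e \<in> E" for e
    using cinner_residual_orthonormal[OF E that] .
  have "cinner ?r ?r = cinner ?r v + cinner ?r (- projection_onto E v)"
    by (subst cinner_add_right[symmetric]) simp
  also have "cinner ?r (- projection_onto E v) = 0"
    unfolding projection_onto_def
    by (subst scaleC_minus_one[symmetric])
      (simp add: cinner_scaleC_right cinner_sum_right r[unfolded projection_onto_def])
  also have "cinner ?r v + 0 = cinner v v - (\<Sum>e\<in>E. cinner v e * cinner e v)"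
    by (simp add: cinner_diff_left projection_onto_def cinner_sum_left cinner_scaleC_left)
  also have "(\<Sum>e\<in>E. cinner v e * cinner e v) = complex_of_real (\<Sum>e\<in>E. (norm (cinner v e))\<^sup>2)"
    unfolding of_real_sum
    by (intro sum.cong refl) (metis cinner_commute complex_norm_square)
  finally have "complex_of_real ((norm ?r)\<^sup>2) =
      complex_of_real ((norm v)\<^sup>2 - (\<Sum>e\<in>E. (norm (cinner v e))\<^sup>2))"
    by (simp only: cinner_self of_real_diff)
  then have "(norm ?r)\<^sup>2 = (norm v)\<^sup>2 - (\<Sum>e\<in>E. (norm (cinner v e))\<^sup>2)"
    by (simp only: of_real_eq_iff)
  then show ?thesis
    using zero_le_power2[of "norm ?r"] by linarith
qed

text \<open>
  The normalised residual of a vector that differs from its projection would enlarge the set.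
\<close>

lemma maximal_orthonormal_set_expansion:
  fixes E :: "'h::chilbert_space set"
  assumes E: "orthonormal_set E" and max: "\<And>E' :: 'h set. orthonormal_set E' \<Longrightarrow> card E' \<le> card E"
  shows "projection_onto E v = v"
proof (rule ccontr)
  let ?r = "v - projection_onto E v"
  assume "projection_onto E v \<noteq> v"
  then have r0: "?r \<noteq> 0" by simp
  define u where "u = complex_of_real (1 / norm ?r) *\<^sub>C ?r"
  have nu: "norm u = 1" using r0 unfolding u_def scaleC_of_real by simp
  have ue: "cinner u e = 0" if "e \<in> E" for e
    using cinner_residual_orthonormal[OF E that] by (simp add: u_def cinner_scaleC_left)
  then have eu: "cinner e u = 0" if "e \<in> E" for e
    using that by (metis cinner_commute complex_cnj_zero)
  have "u \<notin> E"
    using ue nu by (force simp: cinner_self)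
  moreover have "orthonormal_set (insert u E)"
    using E nu ue eu by (auto simp: orthonormal_set_def)
  ultimately show False
    using max[of "insert u E"] E by (simp add: orthonormal_set_def)
qed

text \<open>
  Real spans suffice for the dimension count, since real linear relations are in
  particular complex ones; each basis vector then contributes itself and its multiple by $i$.
\<close>

lemma bounded_orthonormal_imp_finitely_spanned:
  assumes bound: "\<And>E :: 'h::chilbert_space set. orthonormal_set E \<Longrightarrow> card E \<le> N"
  shows "\<exists>B :: 'h set. finite B \<and> span B = UNIV"
proof -
  have "orthonormal_set ({} :: 'h set)" by (simp add: orthonormal_set_def)
  moreover have "\<forall>E :: 'h set. orthonormal_set E \<longrightarrow> card E < Suc N"
    using bound by (simp add: less_Suc_eq_le)
  ultimately obtain E :: "'h set" where E: "orthonormal_set E"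
      "\<And>E' :: 'h set. orthonormal_set E' \<Longrightarrow> card E' \<le> card E"
    using ex_has_greatest_nat[of orthonormal_set "{}" card "Suc N"] by blast
  let ?B = "E \<union> (\<lambda>e. \<i> *\<^sub>C e) ` E"
  have "v \<in> span ?B" for v
  proof -
    have "cinner v e *\<^sub>C e \<in> span ?B" if "e \<in> E" for e
    proof -
      have "cinner v e *\<^sub>C e =
          (complex_of_real (Re (cinner v e)) + complex_of_real (Im (cinner v e)) * \<i>) *\<^sub>C e"
        by (metis complex_eq mult.commute)
      also have "\<dots> = Re (cinner v e) *\<^sub>R e + Im (cinner v e) *\<^sub>R (\<i> *\<^sub>C e)"
        by (simp only: scaleC_add_left scaleC_of_real scaleC_scaleC[symmetric])
      also have "\<dots> \<in> span ?B"
        using that by (intro span_add span_scale span_base) auto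
      finally show ?thesis .
    qed
    then have "projection_onto E v \<in> span ?B"
      unfolding projection_onto_def by (intro span_sum)
    then show ?thesis using maximal_orthonormal_set_expansion[OF E] by simp
  qed
  moreover have "finite ?B" using E(1) by (simp add: orthonormal_set_def)
  ultimately show ?thesis by (intro exI[of _ ?B]) auto
qed

section \<open>Unitary representations\<close>

lemma unitary_representation_zero:
  fixes \<pi> :: "'g::topological_group_add \<Rightarrow> 'h \<Rightarrow> 'h::chilbert_space"
  assumes "unitary_representation \<pi>"
  shows "\<pi> 0 v = v"
proof -
  have "surj (\<pi> 0)" "\<pi> (0 + 0) = \<pi> 0 \<circ> \<pi> 0"
    using assms unfolding unitary_representation_def unitary_operator_def by blast+
  then show ?thesis by (metis add_0 comp_apply surjD)
qed

lemma unitary_representation_cinner_shift: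
  fixes \<pi> :: "'g::topological_group_add \<Rightarrow> 'h \<Rightarrow> 'h::chilbert_space"
  assumes "unitary_representation \<pi>"
  shows "cinner (\<pi> y f) (\<pi> x v) = cinner f (\<pi> (- y + x) v)"
proof -
  have "\<pi> x v = \<pi> y (\<pi> (- y + x) v)"
    using assms unfolding unitary_representation_def
    by (metis add.assoc add.right_inverse add_0 comp_apply)
  moreover have "cinner (\<pi> y a) (\<pi> y b) = cinner a b" for a b
    using assms by (simp add: unitary_representation_def unitary_operator_def)
  ultimately show ?thesis by metis
qed

lemma unitary_operator_norm: "unitary_operator U \<Longrightarrow> norm (U v) = norm v"
  unfolding unitary_operator_def
  by (metis cinner_self norm_ge_zero of_real_eq_iff power2_eq_iff_nonneg)

lemma unitary_operator_linear: "unitary_operator U \<Longrightarrow> linear U"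
  by (rule linearI) (auto simp: unitary_operator_def scaleC_of_real[symmetric])

lemma unitary_operator_continuous: "unitary_operator U \<Longrightarrow> continuous_on UNIV U"
  by (intro linear_continuous_on bounded_linear_intro[where K = 1])
    (auto simp: unitary_operator_norm linear_add linear_scale dest: unitary_operator_linear)

section \<open>Interpolation and linear relations in an orbit\<close>

text \<open>
  The quadratic form of the kernel at $c$ is the squared norm of $\sum_x c(x)\, \pi(x) g$.
\<close>

lemma orbit_independent:
  fixes \<pi> :: "'g \<Rightarrow> 'h \<Rightarrow> 'h::chilbert_space"
  assumes "admissible \<mu> \<pi> g" and "fully_interpolating (wavelet_space \<pi> g) (L2_inner \<mu>)"
    and "finite \<Omega>" and rel: "(\<Sum>x\<in>\<Omega>. c x *\<^sub>C \<pi> x g) = 0" and "x \<in> \<Omega>"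
  shows "c x = 0"
proof (rule ccontr)
  assume "c x \<noteq> 0"
  moreover have "strictly_positive_definite_on \<Omega> (\<lambda>x y. cinner (\<pi> y g) (\<pi> x g))"
    using assms fully_interpolating_wavelet_space by blast
  ultimately have "Re (\<Sum>x\<in>\<Omega>. \<Sum>y\<in>\<Omega>. cnj (c x) * cinner (\<pi> y g) (\<pi> x g) * c y) > 0"
    using \<open>x \<in> \<Omega>\<close> unfolding strictly_positive_definite_on_def by blast
  also have "(\<Sum>x\<in>\<Omega>. \<Sum>y\<in>\<Omega>. cnj (c x) * cinner (\<pi> y g) (\<pi> x g) * c y) =
      cinner (\<Sum>y\<in>\<Omega>. c y *\<^sub>C \<pi> y g) (\<Sum>x\<in>\<Omega>. c x *\<^sub>C \<pi> x g)"
    by (simp add: cinner_sum_left cinner_sum_right cinner_scaleC_left cinner_scaleC_right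
        sum_distrib_left mult_ac)
  finally show False by (simp add: rel cinner_zero_left)
qed

lemma orbit_not_proportional:
  fixes \<pi> :: "'g \<Rightarrow> 'h \<Rightarrow> 'h::chilbert_space"
  assumes "admissible \<mu> \<pi> g" and "fully_interpolating (wavelet_space \<pi> g) (L2_inner \<mu>)"
    and "x \<noteq> y"
  shows "\<pi> y g \<noteq> t *\<^sub>C \<pi> x g"
proof
  assume "\<pi> y g = t *\<^sub>C \<pi> x g"
  then have "(\<Sum>z\<in>{x, y}. (if z = y then -1 else t) *\<^sub>C \<pi> z g) = 0"
    using \<open>x \<noteq> y\<close> by (simp add: scaleC_minus_one)
  from orbit_independent[OF assms(1,2) _ this, of y] show False by simp
qed

section \<open>Abelian groups\<close>

text \<open>
  The factor is the value at $(\pi(-y)g, g)$ of the second factor in the orthogonality relations;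
  commutativity also makes $W_{\pi(-y)g}(\pi(-y)g) = W_g g$, so that $\pi(-y)g$ is in the domain of
  the Duflo-Moore operator.
\<close>

lemma abelian_acts_by_scalars:
  fixes \<pi> :: "'g::topological_group_add \<Rightarrow> 'h \<Rightarrow> 'h::chilbert_space"
  assumes comm: "\<forall>x y :: 'g. x + y = y + x"
    and rep: "unitary_representation \<pi>" and adm: "admissible \<mu> \<pi> g"
  shows "\<exists>t. \<forall>f. \<pi> y f = t *\<^sub>C f"
proof -
  obtain C where C: "duflo_moore_operator \<mu> \<pi> C"
    using adm by (auto simp: admissible_def)
  have uni: "unitary_operator (\<pi> z)" for z
    using rep by (simp add: unitary_representation_def)
  have mult: "\<pi> a (\<pi> b v) = \<pi> (a + b) v" for a b v
    using rep by (simp add: unitary_representation_def)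
  have "wavelet \<pi> (\<pi> (- y) g) (\<pi> (- y) g) = wavelet \<pi> g g"
  proof
    fix x
    have "\<pi> x (\<pi> (- y) g) = \<pi> (- y) (\<pi> x g)" using comm by (metis mult)
    then show "wavelet \<pi> (\<pi> (- y) g) (\<pi> (- y) g) x = wavelet \<pi> g g x"
      using uni[of "- y"] by (simp add: wavelet_def unitary_operator_def)
  qed
  moreover have sq: "square_integrable_vector \<mu> \<pi> g"
    using adm by (simp add: admissible_def)
  moreover have "\<pi> (- y) g \<noteq> 0"
    using sq unitary_operator_norm[OF uni[of "- y"], of g]
    by (auto simp: square_integrable_vector_def)
  ultimately have D: "\<pi> (- y) g \<in> duflo_moore_domain \<mu> \<pi>" "g \<in> duflo_moore_domain \<mu> \<pi>"
    by (auto simp: duflo_moore_domain_def square_integrable_vector_def)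
  define t where "t = cnj (cinner (C (\<pi> (- y) g)) (C g))"
  have inner: "cinner (\<pi> y f1) f2 = cinner (t *\<^sub>C f1) f2" for f1 f2
  proof -
    have "wavelet \<pi> g (\<pi> y f1) = wavelet \<pi> (\<pi> (- y) g) f1"
      using comm by (auto simp: wavelet_def unitary_representation_cinner_shift[OF rep] mult)
    then have "cinner (\<pi> y f1) f2 = L2_inner \<mu> (wavelet \<pi> (\<pi> (- y) g) f1) (wavelet \<pi> g f2)"
      using admissible_isometry(2)[OF adm] by metis
    also have "\<dots> = cinner f1 f2 * t"
      using C D unfolding duflo_moore_operator_def Let_def t_def by blast
    finally show ?thesis by (simp add: cinner_scaleC_left)
  qed
  have "\<pi> y f = t *\<^sub>C f" for f
    using cinner_self_eq_0_iff[of "\<pi> y f - t *\<^sub>C f"] by (simp add: cinner_diff_left inner)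
  then show ?thesis by blast
qed

section \<open>Compact groups\<close>

lemma finite_measure_imp_finitely_spanned:
  fixes \<pi> :: "'g::topological_group_add \<Rightarrow> 'h \<Rightarrow> 'h::chilbert_space"
  assumes rep: "unitary_representation \<pi>" and adm: "admissible \<mu> \<pi> g"
    and fin: "finite_measure \<mu>"
  shows "\<exists>B :: 'h set. finite B \<and> span B = UNIV"
proof (rule bounded_orthonormal_imp_finitely_spanned)
  interpret finite_measure \<mu> by (rule fin)
  fix E :: "'h set" assume E: "orthonormal_set E"
  have int: "integrable \<mu> (\<lambda>x. (norm (wavelet \<pi> g e x))\<^sup>2)" for e
    using admissible_isometry(1)[OF adm] by (simp add: L2_function_def)
  have one: "(LINT x|\<mu>. (norm (wavelet \<pi> g e x))\<^sup>2) = 1" if "e \<in> E" for e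
  proof -
    have "complex_of_real (LINT x|\<mu>. (norm (wavelet \<pi> g e x))\<^sup>2)
        = L2_inner \<mu> (wavelet \<pi> g e) (wavelet \<pi> g e)"
      unfolding L2_inner_def integral_complex_of_real[symmetric] complex_norm_square ..
    also have "\<dots> = 1"
      using E that by (simp add: admissible_isometry(2)[OF adm] cinner_self orthonormal_set_def)
    finally show ?thesis by (simp only: of_real_eq_1_iff)
  qed
  have pointwise: "(\<Sum>e\<in>E. (norm (wavelet \<pi> g e x))\<^sup>2) \<le> (norm g)\<^sup>2" for x
  proof -
    have "norm (wavelet \<pi> g e x) = norm (cinner (\<pi> x g) e)" for e
      by (metis wavelet_def cinner_commute complex_mod_cnj)
    moreover have "norm (\<pi> x g) = norm g"
      using rep by (intro unitary_operator_norm) (simp add: unitary_representation_def)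
    ultimately show ?thesis using Bessel_inequality[OF E, of "\<pi> x g"] by simp
  qed
  have "real (card E) = (LINT x|\<mu>. (\<Sum>e\<in>E. (norm (wavelet \<pi> g e x))\<^sup>2))"
    using one int by (subst Bochner_Integration.integral_sum) auto
  also have "\<dots> \<le> (LINT x|\<mu>. (norm g)\<^sup>2)"
    using int pointwise by (intro integral_mono) auto
  also have "\<dots> = measure \<mu> (space \<mu>) * (norm g)\<^sup>2" by simp
  also have "\<dots> \<le> real (nat \<lceil>measure \<mu> (space \<mu>) * (norm g)\<^sup>2\<rceil>)" by linarith
  finally show "card E \<le> nat \<lceil>measure \<mu> (space \<mu>) * (norm g)\<^sup>2\<rceil>" by simp
qed

text \<open>
  An infinite family of vectors in a finite-dimensional space satisfies a linear relation, except that
  a repetition in the family is not seen by dependence of its range and is a relation of its own.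
\<close>

lemma finitely_spanned_infinite_not_fully_interpolating:
  fixes \<pi> :: "'g \<Rightarrow> 'h \<Rightarrow> 'h::chilbert_space"
  assumes inf: "infinite (UNIV :: 'g set)" and B: "finite B" "span B = (UNIV :: 'h set)"
    and adm: "admissible \<mu> \<pi> g"
  shows "\<not> fully_interpolating (wavelet_space \<pi> g) (L2_inner \<mu>)"
proof
  assume fi: "fully_interpolating (wavelet_space \<pi> g) (L2_inner \<mu>)"
  have inj: "inj (\<lambda>x. \<pi> x g)"
    using orbit_not_proportional[OF adm fi, of _ _ 1] by (intro injI) (metis scaleC_one)
  then have "infinite (range (\<lambda>x. \<pi> x g))" using inf finite_imageD by blast
  then have "dependent (range (\<lambda>x. \<pi> x g))"
    using independent_span_bound[OF B(1), of "range (\<lambda>x. \<pi> x g)"] B(2) by auto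
  then obtain S u v where S: "finite S" "S \<subseteq> range (\<lambda>x. \<pi> x g)" "v \<in> S" "u v \<noteq> 0"
      "(\<Sum>w\<in>S. u w *\<^sub>R w) = 0"
    unfolding dependent_explicit by blast
  obtain \<Omega> where \<Omega>: "finite \<Omega>" "S = (\<lambda>x. \<pi> x g) ` \<Omega>"
    using finite_subset_image[OF S(1,2)] by blast
  then obtain x where x: "x \<in> \<Omega>" "v = \<pi> x g" using S(3) by blast
  have "(\<Sum>z\<in>\<Omega>. complex_of_real (u (\<pi> z g)) *\<^sub>C \<pi> z g) = 0"
    using S(5) unfolding \<Omega>(2)
    by (subst (asm) sum.reindex) (auto simp: scaleC_of_real intro: inj_on_subset[OF inj])
  from orbit_independent[OF adm fi \<Omega>(1) this x(1)] show False
    using S(4) x(2) by simp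
qed

lemma finite_group_orbit_relation:
  fixes \<pi> :: "'g::topological_group_add \<Rightarrow> 'h \<Rightarrow> 'h::chilbert_space"
  assumes fin: "finite (UNIV :: 'g set)" and rep: "unitary_representation \<pi>"
    and irr: "irreducible_representation \<pi>"
  shows "(\<forall>x v. \<pi> x v = v) \<or> (\<forall>v. (\<Sum>x\<in>UNIV. \<pi> x v) = 0)"
proof -
  have uni: "unitary_operator (\<pi> x)" for x
    using rep by (simp add: unitary_representation_def)
  define S where "S = {v. \<forall>x. \<pi> x v = v}"
  have "csubspace S"
    using uni linear_0[OF unitary_operator_linear[OF uni]]
    by (auto simp: csubspace_def S_def unitary_operator_def)
  moreover have "closed S"
    unfolding S_def
    by (intro closed_Collect_all closed_Collect_eq continuous_on_id unitary_operator_continuous uni)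
  moreover have "\<forall>x. \<pi> x ` S \<subseteq> S" by (auto simp: S_def)
  ultimately have "S = {0} \<or> S = UNIV"
    using irr unfolding irreducible_representation_def by blast
  moreover have "(\<Sum>x\<in>UNIV. \<pi> x v) \<in> S" for v
  proof -
    have "\<pi> y (\<Sum>x\<in>UNIV. \<pi> x v) = (\<Sum>x\<in>UNIV. \<pi> x v)" for y
    proof -
      have "\<pi> y (\<Sum>x\<in>UNIV. \<pi> x v) = (\<Sum>x\<in>UNIV. \<pi> (y + x) v)"
        using rep linear_sum[OF unitary_operator_linear[OF uni]]
        by (simp add: unitary_representation_def)
      also have "\<dots> = (\<Sum>x\<in>UNIV. \<pi> x v)"
        by (rule sum.reindex_bij_witness[of _ "\<lambda>x. - y + x" "\<lambda>x. y + x"])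
          (auto simp: add.assoc[symmetric])
      finally show ?thesis .
    qed
    then show ?thesis by (simp add: S_def)
  qed
  ultimately show ?thesis unfolding S_def by blast
qed

section \<open>Wavelet spaces of abelian and compact groups\<close>

theorem proposition5p3:
  fixes \<mu> :: "'g::{topological_group_add, t2_space} measure"
    and \<pi> :: "'g \<Rightarrow> 'h \<Rightarrow> 'h::chilbert_space"
    and g :: 'h
  assumes "locally_compact_space (euclidean :: 'g topology)"
    and "\<exists>x y :: 'g. x \<noteq> y"
    and "(\<forall>x y :: 'g. x + y = y + x) \<or> compact (UNIV :: 'g set)"
    and "left_haar_measure \<mu>"
    and "square_integrable_representation \<mu> \<pi>"
    and "admissible \<mu> \<pi> g"
  shows "\<not> fully_interpolating (wavelet_space \<pi> g) (L2_inner \<mu>)"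
proof
  assume fi: "fully_interpolating (wavelet_space \<pi> g) (L2_inner \<mu>)"
  note adm = assms(6)
  have rep: "unitary_representation \<pi>" and irr: "irreducible_representation \<pi>"
    using assms(5) by (auto simp: square_integrable_representation_def)
  obtain y :: 'g where y: "y \<noteq> 0" using assms(2) by metis
  have not_scalar: "\<pi> y g \<noteq> t *\<^sub>C g" for t
    using orbit_not_proportional[OF adm fi, of 0 y t] y unitary_representation_zero[OF rep] by auto
  show False
  proof (cases "\<forall>x y :: 'g. x + y = y + x")
    case True
    then show False using abelian_acts_by_scalars[OF True rep adm, of y] not_scalar by blast
  next
    case False
    then have "compact (UNIV :: 'g set)" using assms(3) by blast
    moreover have "\<forall>K. compact K \<longrightarrow> emeasure \<mu> K < \<infinity>"
      using assms(4) unfolding left_haar_measure_def by (elim conjE)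
    moreover have sets: "sets \<mu> = sets borel"
      using assms(4) unfolding left_haar_measure_def by (elim conjE)
    ultimately have "emeasure \<mu> UNIV < \<infinity>" by blast
    then have fin: "finite_measure \<mu>"
      using sets_eq_imp_space_eq[OF sets] by (intro finite_measureI) auto
    obtain B :: "'h set" where B: "finite B" "span B = UNIV"
      using finite_measure_imp_finitely_spanned[OF rep adm fin] by blast
    show False
    proof (cases "finite (UNIV :: 'g set)")
      case True
      from finite_group_orbit_relation[OF this rep irr] not_scalar[of 1]
      have "(\<Sum>x\<in>UNIV. 1 *\<^sub>C \<pi> x g) = 0" by (auto simp: scaleC_one)
      from orbit_independent[OF adm fi True this, of 0] show False by simp
    next
      case False
      then show False using finitely_spanned_infinite_not_fully_interpolating[OF False B adm] fi by blast
    qed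
  qed
qed

end
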